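(* Let $M$ be a system F term and $t$ a regular pseudo-term. Then $t$ is a decoration of $M$ (i.e. $t^-=M$) if and only if there is an instantiation $\phi$ admissible for the free decoration $\tilde M$ of $M$ such that $\phi(\tilde M)=t$.
   Context: System F types $T ::= \alpha\mid T\to U\mid\forall\alpha.T$; Church-style system F terms $x^T$, $\lambda x^T.M$, $(M)N$, $\Lambda\alpha.M$, $(M)T$. $DLAL\star$ types: linear $A ::= \alpha\mid D\multimap A\mid\forall\alpha.A\mid\S A$, arbitrary $D ::= A\mid !A$. Pseudo-terms: $t ::= x^D\mid\lambda x^D.t\mid(t)t\mid\Lambda\alpha.t\mid(t)A\mid\S t\mid\bar\S t$ ($A$ linear). Erasure $(\cdot)^-$ forgets $\S,\bar\S,!$, maps $\multimap$ to $\to$, $x^D$ to $x^{D^-}$, $(t)A$ to $(t)A^-$. A pseudo-term is regular if it has no subterm $\S\bar\S u$ or $\bar\S\S u$; for $k\in\mathbb Z$, $\S^k u$ denotes $k$ copies of $\S$ if $k\ge0$ and $-k$ copies of $\bar\S$ if $k<0$. Parameters: integer parameters $\mathsf m,\mathsf n,\dots$ (ranging over $\mathbb Z$), boolean parameters $\mathsf b,\dots$ (ranging over $\{0,1\}$), linear combinations $\mathsf c=\mathsf n_1+\dots+\mathsf n_k$ ($k\ge0$; $\mathsf 0$ when $k=0$). Parameterized types (p-types): $F ::= \alpha\mid D\multimap A\mid\forall\alpha.A$, linear p-types $A ::= \S^{\mathsf c}F$, bang p-types $D ::= \S^{\mathsf b,\mathsf c}F$. For $A=\S^{\mathsf c}F$,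 $B[A/\alpha]$ replaces each $\S^{\mathsf c'}\alpha$ by $\S^{\mathsf c'+\mathsf c}F$ and each $\S^{\mathsf b,\mathsf c'}\alpha$ by $\S^{\mathsf b,\mathsf c'+\mathsf c}F$. P-terms: $u ::= x^D\mid\lambda x^D.t\mid(t)t\mid\Lambda\alpha.t\mid(t)A$, $t ::= \S^{\mathsf m}u$ ($\mathsf m$ an integer parameter, $D$ bang p-type, $A$ linear p-type). Erasure of p-types/p-terms forgets modalities and parameters. An instantiation $\phi=(\phi^b,\phi^i)$ maps boolean parameters to $\{0,1\}$ and integer parameters to $\mathbb Z$, extended additively to linear combinations. $\phi$ is admissible for a p-type $E$ if $\phi^i(\mathsf c)\ge0$ for every linear combination $\mathsf c$ in $E$, and $\phi^b(\mathsf b)=1$ implies $\phi^i(\mathsf c)\ge1$ whenever $\S^{\mathsf b,\mathsf c}F$ occurs in $E$; it is admissible for a p-term if admissible for all p-types in it. Then $\phi(\S^{\mathsf c}F)=\S^{\phi^i(\mathsf c)}\phi(F)$; $\phi(\S^{\mathsf b,\mathsf c}F)=\S^{\phi^i(\mathsf c)}\phi(F)$ if $\phi^b(\mathsf b)=0$ and $!\S^{\phi^i(\mathsf c)-1}\phi(F)$ otherwise; $\phi$ commutes with other connectives. $\phi(t)$ replaces each $\S^{\mathsf m}u$ by $\S^{\phi^i(\mathsf m)}u$, each $x^D$ by $x^{\phi(D)}$ and each $(t)A$ by $(t)\phi(A)$. A free linear (resp. bang) decoration of a system F type $T$ is a linear (resp. bang) p-type $E$ with $E^-=T$, each linear combination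 in $E$ a single integer parameter, and all parameters of $E$ mutually distinct. The free decoration $\tilde M$ of $M$ (unique up to renaming of parameters): each variable $x^T$ is assigned $x^D$ with $D$ a free bang decoration of $T$, distinct variables getting decorations with disjoint parameter sets; then $\widetilde{x^T}=\S^{\mathsf m}x^D$, $\widetilde{\lambda x^T.M}=\S^{\mathsf m}\lambda x^{D}.\tilde M$, $\widetilde{(M)N}=\S^{\mathsf m}((\tilde M)\tilde N)$, $\widetilde{\Lambda\alpha.M}=\S^{\mathsf m}\Lambda\alpha.\tilde M$, $\widetilde{(M)T}=\S^{\mathsf m}((\tilde M)A)$, where each $\mathsf m$ is a fresh integer parameter and $A$ is a free linear decoration of $T$ with parameters disjoint from those in $\tilde M$. *)

theory Defs
  imports Main
begin

(* Type variables and term variables are de Bruijn indices (two separate index spaces),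
   so equality of types and terms is equality up to renaming of bound variables. *)

section \<open>System F\<close>

datatype ftype =
    FTVar nat
  | FTFun ftype ftype
  | FTAll ftype

datatype fterm =
    FVar nat ftype
  | FLam ftype fterm
  | FApp fterm fterm
  | FTLam fterm
  | FTApp fterm ftype

definition shift_ix :: "nat \<Rightarrow> nat \<Rightarrow> nat" where
  "shift_ix k i = (if i < k then i else Suc i)"

primrec shift_ftype :: "nat \<Rightarrow> ftype \<Rightarrow> ftype" where
  "shift_ftype k (FTVar i) = FTVar (shift_ix k i)"
| "shift_ftype k (FTFun T U) = FTFun (shift_ftype k T) (shift_ftype k U)"
| "shift_ftype k (FTAll T) = FTAll (shift_ftype (Suc k) T)"

(* Church style: a variable comes with its type, so all its occurrences carry the annotation
   of its binder (of the environment, if it is free). The shift under a type abstraction is the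
   condition that the bound type variable is not free in the types of free term variables. *)
primrec church_fterm :: "(nat \<Rightarrow> ftype) \<Rightarrow> fterm \<Rightarrow> bool" where
  "church_fterm \<Gamma> (FVar i T) \<longleftrightarrow> T = \<Gamma> i"
| "church_fterm \<Gamma> (FLam T M) \<longleftrightarrow> church_fterm (case_nat T \<Gamma>) M"
| "church_fterm \<Gamma> (FApp M N) \<longleftrightarrow> church_fterm \<Gamma> M \<and> church_fterm \<Gamma> N"
| "church_fterm \<Gamma> (FTLam M) \<longleftrightarrow> church_fterm (\<lambda>i. shift_ftype 0 (\<Gamma> i)) M"
| "church_fterm \<Gamma> (FTApp M T) \<longleftrightarrow> church_fterm \<Gamma> M"

definition system_F_term :: "fterm \<Rightarrow> bool" where
  "system_F_term M \<longleftrightarrow> (\<exists>\<Gamma>. church_fterm \<Gamma> M)"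

primrec free_vars :: "fterm \<Rightarrow> nat set" where
  "free_vars (FVar i T) = {i}"
| "free_vars (FLam T M) = {i. Suc i \<in> free_vars M}"
| "free_vars (FApp M N) = free_vars M \<union> free_vars N"
| "free_vars (FTLam M) = free_vars M"
| "free_vars (FTApp M T) = free_vars M"


section \<open>DLAL* types and pseudo-terms\<close>

datatype
  linty =
    LTVar nat
  | LTFun arbty linty
  | LTAll linty
  | LTPar linty
and
  arbty =
    ALin linty
  | ABang linty

(* TPar is the paragraph sign, TBar its barred dual. *)
datatype pseudoterm =
    TVar nat arbty
  | TLam arbty pseudoterm
  | TApp pseudoterm pseudoterm
  | TTLam pseudoterm
  | TTApp pseudoterm linty
  | TPar pseudoterm
  | TBar pseudoterm

primrec shift_linty :: "nat \<Rightarrow> linty \<Rightarrow> linty"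
  and shift_arbty :: "nat \<Rightarrow> arbty \<Rightarrow> arbty" where
  "shift_linty k (LTVar i) = LTVar (shift_ix k i)"
| "shift_linty k (LTFun D A) = LTFun (shift_arbty k D) (shift_linty k A)"
| "shift_linty k (LTAll A) = LTAll (shift_linty (Suc k) A)"
| "shift_linty k (LTPar A) = LTPar (shift_linty k A)"
| "shift_arbty k (ALin A) = ALin (shift_linty k A)"
| "shift_arbty k (ABang A) = ABang (shift_linty k A)"

primrec church_pseudoterm :: "(nat \<Rightarrow> arbty) \<Rightarrow> pseudoterm \<Rightarrow> bool" where
  "church_pseudoterm \<Delta> (TVar i D) \<longleftrightarrow> D = \<Delta> i"
| "church_pseudoterm \<Delta> (TLam D t) \<longleftrightarrow> church_pseudoterm (case_nat D \<Delta>) t"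
| "church_pseudoterm \<Delta> (TApp t s) \<longleftrightarrow> church_pseudoterm \<Delta> t \<and> church_pseudoterm \<Delta> s"
| "church_pseudoterm \<Delta> (TTLam t) \<longleftrightarrow> church_pseudoterm (\<lambda>i. shift_arbty 0 (\<Delta> i)) t"
| "church_pseudoterm \<Delta> (TTApp t A) \<longleftrightarrow> church_pseudoterm \<Delta> t"
| "church_pseudoterm \<Delta> (TPar t) \<longleftrightarrow> church_pseudoterm \<Delta> t"
| "church_pseudoterm \<Delta> (TBar t) \<longleftrightarrow> church_pseudoterm \<Delta> t"

definition pseudo_term :: "pseudoterm \<Rightarrow> bool" where
  "pseudo_term t \<longleftrightarrow> (\<exists>\<Delta>. church_pseudoterm \<Delta> t)"

primrec erase_linty :: "linty \<Rightarrow> ftype"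
  and erase_arbty :: "arbty \<Rightarrow> ftype" where
  "erase_linty (LTVar i) = FTVar i"
| "erase_linty (LTFun D A) = FTFun (erase_arbty D) (erase_linty A)"
| "erase_linty (LTAll A) = FTAll (erase_linty A)"
| "erase_linty (LTPar A) = erase_linty A"
| "erase_arbty (ALin A) = erase_linty A"
| "erase_arbty (ABang A) = erase_linty A"

primrec erase_pseudoterm :: "pseudoterm \<Rightarrow> fterm" where
  "erase_pseudoterm (TVar i D) = FVar i (erase_arbty D)"
| "erase_pseudoterm (TLam D t) = FLam (erase_arbty D) (erase_pseudoterm t)"
| "erase_pseudoterm (TApp t s) = FApp (erase_pseudoterm t) (erase_pseudoterm s)"
| "erase_pseudoterm (TTLam t) = FTLam (erase_pseudoterm t)"
| "erase_pseudoterm (TTApp t A) = FTApp (erase_pseudoterm t) (erase_linty A)"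
| "erase_pseudoterm (TPar t) = erase_pseudoterm t"
| "erase_pseudoterm (TBar t) = erase_pseudoterm t"

definition decoration_of :: "pseudoterm \<Rightarrow> fterm \<Rightarrow> bool" where
  "decoration_of t M \<longleftrightarrow> erase_pseudoterm t = M"

primrec subterms :: "pseudoterm \<Rightarrow> pseudoterm set" where
  "subterms (TVar i D) = {TVar i D}"
| "subterms (TLam D t) = insert (TLam D t) (subterms t)"
| "subterms (TApp t s) = insert (TApp t s) (subterms t \<union> subterms s)"
| "subterms (TTLam t) = insert (TTLam t) (subterms t)"
| "subterms (TTApp t A) = insert (TTApp t A) (subterms t)"
| "subterms (TPar t) = insert (TPar t) (subterms t)"
| "subterms (TBar t) = insert (TBar t) (subterms t)"

definition regular :: "pseudoterm \<Rightarrow> bool" where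
  "regular t \<longleftrightarrow> (\<nexists>u. TPar (TBar u) \<in> subterms t \<or> TBar (TPar u) \<in> subterms t)"

definition LTPar_pow :: "nat \<Rightarrow> linty \<Rightarrow> linty" where
  "LTPar_pow k A = (LTPar ^^ k) A"

definition TPar_pow :: "int \<Rightarrow> pseudoterm \<Rightarrow> pseudoterm" where
  "TPar_pow k u = (if k \<ge> 0 then (TPar ^^ nat k) u else (TBar ^^ nat (- k)) u)"


section \<open>Parameterized types and terms\<close>

type_synonym iparam = nat
type_synonym bparam = nat

(* The list [n1, ..., nk] stands for n1 + ... + nk, and [] for 0. *)
type_synonym lincomb = "iparam list"

datatype
  ptype =
    PTVar nat
  | PTFun bangpty linpty
  | PTAll linpty
and
  linpty = LPar lincomb ptype
and
  bangpty = BPar bparam lincomb ptype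

datatype
  pcore =
    PVar nat bangpty
  | PLam bangpty pterm
  | PApp pterm pterm
  | PTLam pterm
  | PTApp pterm linpty
and
  pterm = PPar iparam pcore

primrec shift_ptype :: "nat \<Rightarrow> ptype \<Rightarrow> ptype"
  and shift_linpty :: "nat \<Rightarrow> linpty \<Rightarrow> linpty"
  and shift_bangpty :: "nat \<Rightarrow> bangpty \<Rightarrow> bangpty" where
  "shift_ptype k (PTVar i) = PTVar (shift_ix k i)"
| "shift_ptype k (PTFun D A) = PTFun (shift_bangpty k D) (shift_linpty k A)"
| "shift_ptype k (PTAll A) = PTAll (shift_linpty (Suc k) A)"
| "shift_linpty k (LPar c F) = LPar c (shift_ptype k F)"
| "shift_bangpty k (BPar b c F) = BPar b c (shift_ptype k F)"

primrec erase_ptype :: "ptype \<Rightarrow> ftype"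
  and erase_linpty :: "linpty \<Rightarrow> ftype"
  and erase_bangpty :: "bangpty \<Rightarrow> ftype" where
  "erase_ptype (PTVar i) = FTVar i"
| "erase_ptype (PTFun D A) = FTFun (erase_bangpty D) (erase_linpty A)"
| "erase_ptype (PTAll A) = FTAll (erase_linpty A)"
| "erase_linpty (LPar c F) = erase_ptype F"
| "erase_bangpty (BPar b c F) = erase_ptype F"


section \<open>Instantiations\<close>

type_synonym param_inst = "(bparam \<Rightarrow> bool) \<times> (iparam \<Rightarrow> int)"

definition lincomb_val :: "param_inst \<Rightarrow> lincomb \<Rightarrow> int" where
  "lincomb_val \<phi> c = sum_list (map (snd \<phi>) c)"

primrec admissible_ptype :: "param_inst \<Rightarrow> ptype \<Rightarrow> bool"
  and admissible_linpty :: "param_inst \<Rightarrow> linpty \<Rightarrow> bool"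
  and admissible_bangpty :: "param_inst \<Rightarrow> bangpty \<Rightarrow> bool" where
  "admissible_ptype \<phi> (PTVar i) \<longleftrightarrow> True"
| "admissible_ptype \<phi> (PTFun D A) \<longleftrightarrow> admissible_bangpty \<phi> D \<and> admissible_linpty \<phi> A"
| "admissible_ptype \<phi> (PTAll A) \<longleftrightarrow> admissible_linpty \<phi> A"
| "admissible_linpty \<phi> (LPar c F) \<longleftrightarrow> lincomb_val \<phi> c \<ge> 0 \<and> admissible_ptype \<phi> F"
| "admissible_bangpty \<phi> (BPar b c F) \<longleftrightarrow>
     lincomb_val \<phi> c \<ge> 0 \<and> (fst \<phi> b \<longrightarrow> lincomb_val \<phi> c \<ge> 1) \<and> admissible_ptype \<phi> F"

primrec admissible_pcore :: "param_inst \<Rightarrow> pcore \<Rightarrow> bool"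
  and admissible_pterm :: "param_inst \<Rightarrow> pterm \<Rightarrow> bool" where
  "admissible_pcore \<phi> (PVar i D) \<longleftrightarrow> admissible_bangpty \<phi> D"
| "admissible_pcore \<phi> (PLam D t) \<longleftrightarrow> admissible_bangpty \<phi> D \<and> admissible_pterm \<phi> t"
| "admissible_pcore \<phi> (PApp t s) \<longleftrightarrow> admissible_pterm \<phi> t \<and> admissible_pterm \<phi> s"
| "admissible_pcore \<phi> (PTLam t) \<longleftrightarrow> admissible_pterm \<phi> t"
| "admissible_pcore \<phi> (PTApp t A) \<longleftrightarrow> admissible_pterm \<phi> t \<and> admissible_linpty \<phi> A"
| "admissible_pterm \<phi> (PPar m u) \<longleftrightarrow> admissible_pcore \<phi> u"

(* The truncation performed by nat is harmless: instantiating types is only meaningful for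
   admissible instantiations, which make the exponents below nonnegative. *)
primrec inst_ptype :: "param_inst \<Rightarrow> ptype \<Rightarrow> linty"
  and inst_linpty :: "param_inst \<Rightarrow> linpty \<Rightarrow> linty"
  and inst_bangpty :: "param_inst \<Rightarrow> bangpty \<Rightarrow> arbty" where
  "inst_ptype \<phi> (PTVar i) = LTVar i"
| "inst_ptype \<phi> (PTFun D A) = LTFun (inst_bangpty \<phi> D) (inst_linpty \<phi> A)"
| "inst_ptype \<phi> (PTAll A) = LTAll (inst_linpty \<phi> A)"
| "inst_linpty \<phi> (LPar c F) = LTPar_pow (nat (lincomb_val \<phi> c)) (inst_ptype \<phi> F)"
| "inst_bangpty \<phi> (BPar b c F) =
     (if fst \<phi> b then ABang (LTPar_pow (nat (lincomb_val \<phi> c - 1)) (inst_ptype \<phi> F))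
      else ALin (LTPar_pow (nat (lincomb_val \<phi> c)) (inst_ptype \<phi> F)))"

primrec inst_pcore :: "param_inst \<Rightarrow> pcore \<Rightarrow> pseudoterm"
  and inst_pterm :: "param_inst \<Rightarrow> pterm \<Rightarrow> pseudoterm" where
  "inst_pcore \<phi> (PVar i D) = TVar i (inst_bangpty \<phi> D)"
| "inst_pcore \<phi> (PLam D t) = TLam (inst_bangpty \<phi> D) (inst_pterm \<phi> t)"
| "inst_pcore \<phi> (PApp t s) = TApp (inst_pterm \<phi> t) (inst_pterm \<phi> s)"
| "inst_pcore \<phi> (PTLam t) = TTLam (inst_pterm \<phi> t)"
| "inst_pcore \<phi> (PTApp t A) = TTApp (inst_pterm \<phi> t) (inst_linpty \<phi> A)"
| "inst_pterm \<phi> (PPar m u) = TPar_pow (snd \<phi> m) (inst_pcore \<phi> u)"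


section \<open>Free decorations\<close>

datatype param = BoolP bparam | IntP iparam

primrec params_ptype :: "ptype \<Rightarrow> param list"
  and params_linpty :: "linpty \<Rightarrow> param list"
  and params_bangpty :: "bangpty \<Rightarrow> param list" where
  "params_ptype (PTVar i) = []"
| "params_ptype (PTFun D A) = params_bangpty D @ params_linpty A"
| "params_ptype (PTAll A) = params_linpty A"
| "params_linpty (LPar c F) = map IntP c @ params_ptype F"
| "params_bangpty (BPar b c F) = BoolP b # map IntP c @ params_ptype F"

primrec single_ptype :: "ptype \<Rightarrow> bool"
  and single_linpty :: "linpty \<Rightarrow> bool"
  and single_bangpty :: "bangpty \<Rightarrow> bool" where
  "single_ptype (PTVar i) \<longleftrightarrow> True"
| "single_ptype (PTFun D A) \<longleftrightarrow> single_bangpty D \<and> single_linpty A"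
| "single_ptype (PTAll A) \<longleftrightarrow> single_linpty A"
| "single_linpty (LPar c F) \<longleftrightarrow> (\<exists>n. c = [n]) \<and> single_ptype F"
| "single_bangpty (BPar b c F) \<longleftrightarrow> (\<exists>n. c = [n]) \<and> single_ptype F"

definition free_linear_decoration :: "ftype \<Rightarrow> linpty \<Rightarrow> bool" where
  "free_linear_decoration T A \<longleftrightarrow>
     erase_linpty A = T \<and> single_linpty A \<and> distinct (params_linpty A)"

definition free_bang_decoration :: "ftype \<Rightarrow> bangpty \<Rightarrow> bool" where
  "free_bang_decoration T D \<longleftrightarrow>
     erase_bangpty D = T \<and> single_bangpty D \<and> distinct (params_bangpty D)"

(* The clauses defining the free decoration, without the freshness of parameters.
   The environment gives the decorations assigned to the free variables. *)
inductive decorates :: "(nat \<Rightarrow> bangpty) \<Rightarrow> fterm \<Rightarrow> pterm \<Rightarrow> bool" where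
  dec_Var: "erase_bangpty (\<Theta> i) = T \<Longrightarrow> decorates \<Theta> (FVar i T) (PPar m (PVar i (\<Theta> i)))"
| dec_Lam: "free_bang_decoration T D \<Longrightarrow> decorates (case_nat D \<Theta>) M t \<Longrightarrow>
     decorates \<Theta> (FLam T M) (PPar m (PLam D t))"
| dec_App: "decorates \<Theta> M t \<Longrightarrow> decorates \<Theta> N s \<Longrightarrow>
     decorates \<Theta> (FApp M N) (PPar m (PApp t s))"
| dec_TLam: "decorates (\<lambda>i. shift_bangpty 0 (\<Theta> i)) M t \<Longrightarrow>
     decorates \<Theta> (FTLam M) (PPar m (PTLam t))"
| dec_TApp: "decorates \<Theta> M t \<Longrightarrow> free_linear_decoration T A \<Longrightarrow>
     decorates \<Theta> (FTApp M T) (PPar m (PTApp t A))"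

(* Lists the parameters where they are introduced: the decoration of a bound variable is counted
   once, at its binder, and that of a free variable, which its occurrences share, not at all. *)
primrec own_params_core :: "pcore \<Rightarrow> param list"
  and own_params :: "pterm \<Rightarrow> param list" where
  "own_params_core (PVar i D) = []"
| "own_params_core (PLam D t) = params_bangpty D @ own_params t"
| "own_params_core (PApp t s) = own_params t @ own_params s"
| "own_params_core (PTLam t) = own_params t"
| "own_params_core (PTApp t A) = own_params t @ params_linpty A"
| "own_params (PPar m u) = IntP m # own_params_core u"

(* P is a free decoration of M; a relation, since this determines P only up to renaming of
   parameters. *)
definition free_decoration :: "fterm \<Rightarrow> pterm \<Rightarrow> bool" where
  "free_decoration M P \<longleftrightarrow> (\<exists>\<Theta>.
     decorates \<Theta> M P \<and>
     (\<forall>i\<in>free_vars M. free_bang_decoration (erase_bangpty (\<Theta> i)) (\<Theta> i)) \<and>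
     (\<forall>i\<in>free_vars M. \<forall>j\<in>free_vars M. i \<noteq> j \<longrightarrow>
        set (params_bangpty (\<Theta> i)) \<inter> set (params_bangpty (\<Theta> j)) = {}) \<and>
     distinct (own_params P) \<and>
     (\<forall>i\<in>free_vars M. set (own_params P) \<inter> set (params_bangpty (\<Theta> i)) = {}))"


subsection \<open>Existence of free decorations\<close>

lemma fresh_iparam:
  assumes "finite X"
  obtains n where "IntP n \<notin> X"
proof -
  have "finite (IntP -` X)"
    using assms by (rule finite_vimageI) (simp add: inj_def)
  with that show ?thesis
    using ex_new_if_finite infinite_UNIV_nat by (metis vimageI)
qed

lemma fresh_bparam:
  assumes "finite X"
  obtains b where "BoolP b \<notin> X"
proof -
  have "finite (BoolP -` X)"
    using assms by (rule finite_vimageI) (simp add: inj_def)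
  with that show ?thesis
    using ex_new_if_finite infinite_UNIV_nat by (metis vimageI)
qed

lemma free_ptype_exists:
  "finite X \<Longrightarrow> \<exists>F. erase_ptype F = T \<and> single_ptype F \<and> distinct (params_ptype F) \<and>
     set (params_ptype F) \<inter> X = {}"
proof (induction T arbitrary: X)
  case (FTVar i)
  show ?case by (rule exI[of _ "PTVar i"]) simp
next
  case (FTFun T U)
  obtain F where F: "erase_ptype F = T" "single_ptype F" "distinct (params_ptype F)"
    "set (params_ptype F) \<inter> X = {}"
    using FTFun by blast
  have fin: "finite (X \<union> set (params_ptype F))" using FTFun.prems by simp
  obtain G where G: "erase_ptype G = U" "single_ptype G" "distinct (params_ptype G)"
    "set (params_ptype G) \<inter> (X \<union> set (params_ptype F)) = {}"
    using FTFun.IH(2)[OF fin] by blast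
  define Y where "Y = X \<union> set (params_ptype F) \<union> set (params_ptype G)"
  have Y: "finite Y" using FTFun.prems by (simp add: Y_def)
  obtain b where b: "BoolP b \<notin> Y" using Y by (rule fresh_bparam)
  obtain m where m: "IntP m \<notin> Y" using Y by (rule fresh_iparam)
  obtain n where n: "IntP n \<notin> insert (IntP m) Y" using Y by (rule fresh_iparam[OF finite.insertI])
  show ?case
    by (rule exI[of _ "PTFun (BPar b [m] F) (LPar [n] G)"])
      (use F G b m n in \<open>auto simp: Y_def\<close>)
next
  case (FTAll T)
  obtain F where F: "erase_ptype F = T" "single_ptype F" "distinct (params_ptype F)"
    "set (params_ptype F) \<inter> X = {}"
    using FTAll by blast
  have fin: "finite (X \<union> set (params_ptype F))" using FTAll.prems by simp
  obtain m where m: "IntP m \<notin> X \<union> set (params_ptype F)" using fin by (rule fresh_iparam)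
  show ?case by (rule exI[of _ "PTAll (LPar [m] F)"]) (use F m in auto)
qed

lemma free_linear_decoration_exists:
  assumes "finite X"
  obtains A where "free_linear_decoration T A" "set (params_linpty A) \<inter> X = {}"
proof -
  obtain F where F: "erase_ptype F = T" "single_ptype F" "distinct (params_ptype F)"
    "set (params_ptype F) \<inter> X = {}"
    using free_ptype_exists[OF assms] by blast
  have fin: "finite (X \<union> set (params_ptype F))" using assms by simp
  obtain m where m: "IntP m \<notin> X \<union> set (params_ptype F)" using fin by (rule fresh_iparam)
  show ?thesis
    by (rule that[of "LPar [m] F"]) (use F m in \<open>auto simp: free_linear_decoration_def\<close>)
qed

lemma free_bang_decoration_exists:
  assumes "finite X"
  obtains D where "free_bang_decoration T D" "set (params_bangpty D) \<inter> X = {}"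
proof -
  obtain F where F: "erase_ptype F = T" "single_ptype F" "distinct (params_ptype F)"
    "set (params_ptype F) \<inter> X = {}"
    using free_ptype_exists[OF assms] by blast
  have fin: "finite (X \<union> set (params_ptype F))" using assms by simp
  obtain m where m: "IntP m \<notin> X \<union> set (params_ptype F)" using fin by (rule fresh_iparam)
  obtain b where b: "BoolP b \<notin> X \<union> set (params_ptype F)" using fin by (rule fresh_bparam)
  show ?thesis
    by (rule that[of "BPar b [m] F"]) (use F m b in \<open>auto simp: free_bang_decoration_def\<close>)
qed

lemma erase_shift_ptype:
  "erase_ptype (shift_ptype k F) = shift_ftype k (erase_ptype F)"
  "erase_linpty (shift_linpty k A) = shift_ftype k (erase_linpty A)"
  "erase_bangpty (shift_bangpty k D) = shift_ftype k (erase_bangpty D)"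
  by (induction F and A and D arbitrary: k and k and k) auto

lemma decorates_exists:
  "church_fterm \<Gamma> M \<Longrightarrow> \<forall>i. erase_bangpty (\<Theta> i) = \<Gamma> i \<Longrightarrow> finite X \<Longrightarrow>
     \<exists>P. decorates \<Theta> M P \<and> distinct (own_params P) \<and> set (own_params P) \<inter> X = {}"
proof (induction M arbitrary: \<Gamma> \<Theta> X)
  case (FVar i T)
  obtain m where "IntP m \<notin> X" using FVar.prems(3) by (rule fresh_iparam)
  then show ?case
    using FVar.prems
    by (intro exI[of _ "PPar m (PVar i (\<Theta> i))"]) (auto intro: decorates.intros)
next
  case (FLam T M)
  obtain D where D: "free_bang_decoration T D" "set (params_bangpty D) \<inter> X = {}"
    using FLam.prems(3) by (rule free_bang_decoration_exists)
  have e: "\<forall>i. erase_bangpty (case_nat D \<Theta> i) = case_nat T \<Gamma> i"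
    using D(1) FLam.prems(2) by (auto simp: free_bang_decoration_def split: nat.split)
  have fin: "finite (X \<union> set (params_bangpty D))" using FLam.prems by simp
  obtain P where P: "decorates (case_nat D \<Theta>) M P" "distinct (own_params P)"
    "set (own_params P) \<inter> (X \<union> set (params_bangpty D)) = {}"
    using FLam.IH[OF _ e fin] FLam.prems(1) by auto
  have fin': "finite (X \<union> set (params_bangpty D) \<union> set (own_params P))" using fin by simp
  obtain m where m: "IntP m \<notin> X \<union> set (params_bangpty D) \<union> set (own_params P)"
    using fin' by (rule fresh_iparam)
  show ?case
    by (rule exI[of _ "PPar m (PLam D P)"])
      (use D P m in \<open>auto intro: decorates.intros simp: free_bang_decoration_def\<close>)
next
  case (FApp M N)
  obtain P where P: "decorates \<Theta> M P" "distinct (own_params P)" "set (own_params P) \<inter> X = {}"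
    using FApp.IH(1)[OF _ FApp.prems(2,3)] FApp.prems(1) by auto
  have fin: "finite (X \<union> set (own_params P))" using FApp.prems by simp
  obtain Q where Q: "decorates \<Theta> N Q" "distinct (own_params Q)"
    "set (own_params Q) \<inter> (X \<union> set (own_params P)) = {}"
    using FApp.IH(2)[OF _ FApp.prems(2) fin] FApp.prems(1) by auto
  have fin': "finite (X \<union> set (own_params P) \<union> set (own_params Q))" using fin by simp
  obtain m where m: "IntP m \<notin> X \<union> set (own_params P) \<union> set (own_params Q)"
    using fin' by (rule fresh_iparam)
  show ?case
    by (rule exI[of _ "PPar m (PApp P Q)"]) (use P Q m in \<open>auto intro: decorates.intros\<close>)
next
  case (FTLam M)
  have e: "\<forall>i. erase_bangpty (shift_bangpty 0 (\<Theta> i)) = shift_ftype 0 (\<Gamma> i)"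
    using FTLam.prems(2) by (simp add: erase_shift_ptype)
  obtain P where P: "decorates (\<lambda>i. shift_bangpty 0 (\<Theta> i)) M P" "distinct (own_params P)"
    "set (own_params P) \<inter> X = {}"
    using FTLam.IH[OF _ e FTLam.prems(3)] FTLam.prems(1) by auto
  have fin: "finite (X \<union> set (own_params P))" using FTLam.prems by simp
  obtain m where m: "IntP m \<notin> X \<union> set (own_params P)" using fin by (rule fresh_iparam)
  show ?case
    by (rule exI[of _ "PPar m (PTLam P)"]) (use P m in \<open>auto intro: decorates.intros\<close>)
next
  case (FTApp M T)
  obtain P where P: "decorates \<Theta> M P" "distinct (own_params P)" "set (own_params P) \<inter> X = {}"
    using FTApp.IH[OF _ FTApp.prems(2,3)] FTApp.prems(1) by auto
  have fin: "finite (X \<union> set (own_params P))" using FTApp.prems by simp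
  obtain A where A: "free_linear_decoration T A"
    "set (params_linpty A) \<inter> (X \<union> set (own_params P)) = {}"
    using fin by (rule free_linear_decoration_exists)
  have fin': "finite (X \<union> set (own_params P) \<union> set (params_linpty A))" using fin by simp
  obtain m where m: "IntP m \<notin> X \<union> set (own_params P) \<union> set (params_linpty A)"
    using fin' by (rule fresh_iparam)
  show ?case
    by (rule exI[of _ "PPar m (PTApp P A)"])
      (use P A m in \<open>auto intro: decorates.intros simp: free_linear_decoration_def\<close>)
qed

lemma finite_free_vars: "finite (free_vars M)"
proof (induction M)
  case (FLam T M)
  have "{i. Suc i \<in> free_vars M} = Suc -` free_vars M" by auto
  then show ?case using FLam by (simp add: finite_vimageI)
qed auto

lemma free_env_exists:
  assumes "finite S"
  shows "\<exists>\<Theta>. (\<forall>i. free_bang_decoration (\<Gamma> i) (\<Theta> i)) \<and>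
     (\<forall>i\<in>S. \<forall>j\<in>S. i \<noteq> j \<longrightarrow>
        set (params_bangpty (\<Theta> i)) \<inter> set (params_bangpty (\<Theta> j)) = {})"
  using assms
proof (induction S)
  case empty
  have "\<forall>i. \<exists>D. free_bang_decoration (\<Gamma> i) D"
    by (metis finite.emptyI free_bang_decoration_exists)
  then show ?case by (auto dest: choice)
next
  case (insert k S)
  then obtain \<Theta> where \<Theta>: "\<forall>i. free_bang_decoration (\<Gamma> i) (\<Theta> i)"
    "\<forall>i\<in>S. \<forall>j\<in>S. i \<noteq> j \<longrightarrow>
       set (params_bangpty (\<Theta> i)) \<inter> set (params_bangpty (\<Theta> j)) = {}"
    by blast
  have fin: "finite (\<Union>i\<in>S. set (params_bangpty (\<Theta> i)))" using insert.hyps by simp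
  obtain D where D: "free_bang_decoration (\<Gamma> k) D"
    "set (params_bangpty D) \<inter> (\<Union>i\<in>S. set (params_bangpty (\<Theta> i))) = {}"
    using fin by (rule free_bang_decoration_exists)
  show ?case
    by (rule exI[of _ "\<Theta>(k := D)"]) (use \<Theta> D insert.hyps in \<open>auto; blast\<close>)
qed

lemma free_decoration_exists:
  assumes "system_F_term M"
  shows "\<exists>P. free_decoration M P"
proof -
  obtain \<Gamma> where \<Gamma>: "church_fterm \<Gamma> M" using assms by (auto simp: system_F_term_def)
  obtain \<Theta> where \<Theta>: "\<forall>i. free_bang_decoration (\<Gamma> i) (\<Theta> i)"
    "\<forall>i\<in>free_vars M. \<forall>j\<in>free_vars M. i \<noteq> j \<longrightarrow>
       set (params_bangpty (\<Theta> i)) \<inter> set (params_bangpty (\<Theta> j)) = {}"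
    using free_env_exists[OF finite_free_vars] by blast
  have e: "\<forall>i. erase_bangpty (\<Theta> i) = \<Gamma> i"
    using \<Theta>(1) by (simp add: free_bang_decoration_def)
  have fin: "finite (\<Union>i\<in>free_vars M. set (params_bangpty (\<Theta> i)))"
    by (simp add: finite_free_vars)
  obtain P where "decorates \<Theta> M P" "distinct (own_params P)"
    "set (own_params P) \<inter> (\<Union>i\<in>free_vars M. set (params_bangpty (\<Theta> i))) = {}"
    using decorates_exists[OF \<Gamma> e fin] by blast
  with \<Theta> e have "free_decoration M P"
    unfolding free_decoration_def by (intro exI[of _ \<Theta>]) auto
  then show ?thesis ..
qed

end

theory Submission
  imports Defs
begin

text \<open>
  The free decoration gives a fresh exponent to every node of the term and of its types, so an
  instantiation reproducing a given decoration can be read off node by node: the run of modalities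
  above each node determines the value of its exponent, a bang being counted as one extra unit.
  Regularity makes this exponent a single integer. The only sharing of parameters is between a
  binder (or the environment) and its occurrences, where Church style annotations make the values
  agree; shifting type variables does not affect parameters.
\<close>

text \<open>Instantiations are total, so "\<psi> differs from \<phi> only in the parameters of
  \<open>X\<close>" is expressed as \<open>agree_on (- X) \<psi> \<phi>\<close>. The existence
  lemmas below have this form, so their results can be chained, each starting from the previous
  instantiation.\<close>

definition agree_on :: "param set \<Rightarrow> param_inst \<Rightarrow> param_inst \<Rightarrow> bool" where
  "agree_on X \<phi> \<psi> \<longleftrightarrow>
     (\<forall>b. BoolP b \<in> X \<longrightarrow> fst \<phi> b = fst \<psi> b) \<and> (\<forall>n. IntP n \<in> X \<longrightarrow> snd \<phi> n = snd \<psi> n)"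

lemma agree_on_refl: "agree_on X \<phi> \<phi>"
  by (simp add: agree_on_def)

lemma agree_on_trans: "agree_on X \<phi> \<psi> \<Longrightarrow> agree_on X \<psi> \<chi> \<Longrightarrow> agree_on X \<phi> \<chi>"
  by (simp add: agree_on_def)

lemma agree_on_mono: "agree_on X \<phi> \<psi> \<Longrightarrow> Y \<subseteq> X \<Longrightarrow> agree_on Y \<phi> \<psi>"
  by (auto simp: agree_on_def)

lemma lincomb_val_cong:
  "agree_on (IntP ` set c) \<phi> \<psi> \<Longrightarrow> lincomb_val \<phi> c = lincomb_val \<psi> c"
  unfolding lincomb_val_def by (rule arg_cong[of _ _ sum_list]) (auto simp: agree_on_def)

lemma lincomb_val_single: "lincomb_val \<phi> [n] = snd \<phi> n"
  by (simp add: lincomb_val_def)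


section \<open>Instantiated p-types: dependence on parameters, and shifting\<close>

section \<open>Types\<close>

lemma inst_type_cong:
  "agree_on (set (params_ptype F)) \<phi> \<psi> \<Longrightarrow>
     inst_ptype \<phi> F = inst_ptype \<psi> F \<and> admissible_ptype \<phi> F = admissible_ptype \<psi> F"
  "agree_on (set (params_linpty A)) \<phi> \<psi> \<Longrightarrow>
     inst_linpty \<phi> A = inst_linpty \<psi> A \<and> admissible_linpty \<phi> A = admissible_linpty \<psi> A"
  "agree_on (set (params_bangpty D)) \<phi> \<psi> \<Longrightarrow>
     inst_bangpty \<phi> D = inst_bangpty \<psi> D \<and> admissible_bangpty \<phi> D = admissible_bangpty \<psi> D"
proof (induction F and A and D)
  case (LPar c F)
  have "agree_on (IntP ` set c) \<phi> \<psi>" "agree_on (set (params_ptype F)) \<phi> \<psi>"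
    using LPar.prems by (auto elim: agree_on_mono)
  then show ?case using LPar.IH lincomb_val_cong by simp
next
  case (BPar b c F)
  have "agree_on (IntP ` set c) \<phi> \<psi>" "agree_on (set (params_ptype F)) \<phi> \<psi>"
    using BPar.prems by (auto elim: agree_on_mono)
  moreover have "fst \<phi> b = fst \<psi> b" using BPar.prems by (simp add: agree_on_def)
  ultimately show ?case using BPar.IH lincomb_val_cong by simp
next
  case (PTFun D A)
  have "agree_on (set (params_bangpty D)) \<phi> \<psi>" "agree_on (set (params_linpty A)) \<phi> \<psi>"
    using PTFun.prems by (auto elim: agree_on_mono)
  then show ?case using PTFun.IH by simp
qed auto

lemma shift_LTPar_pow: "shift_linty k (LTPar_pow n A) = LTPar_pow n (shift_linty k A)"
  by (induction n) (auto simp: LTPar_pow_def)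

text \<open>Shifting touches type variable indices and never parameters. This and the next two
  lemmas let the conditions on an environment pass under a type abstraction, where all its entries
  are shifted.\<close>

lemma inst_shift:
  "inst_ptype \<phi> (shift_ptype k F) = shift_linty k (inst_ptype \<phi> F)"
  "inst_linpty \<phi> (shift_linpty k A) = shift_linty k (inst_linpty \<phi> A)"
  "inst_bangpty \<phi> (shift_bangpty k D) = shift_arbty k (inst_bangpty \<phi> D)"
  by (induction F and A and D arbitrary: k and k and k) (auto simp: shift_LTPar_pow)

lemma admissible_shift:
  "admissible_ptype \<phi> (shift_ptype k F) = admissible_ptype \<phi> F"
  "admissible_linpty \<phi> (shift_linpty k A) = admissible_linpty \<phi> A"
  "admissible_bangpty \<phi> (shift_bangpty k D) = admissible_bangpty \<phi> D"
  by (induction F and A and D arbitrary: k and k and k) auto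

lemma params_shift:
  "params_ptype (shift_ptype k F) = params_ptype F"
  "params_linpty (shift_linpty k A) = params_linpty A"
  "params_bangpty (shift_bangpty k D) = params_bangpty D"
  by (induction F and A and D arbitrary: k and k and k) auto

section \<open>Erasing instantiated types, and reading an instantiation off a type\<close>

lemma erase_LTPar_pow: "erase_linty (LTPar_pow n A) = erase_linty A"
  by (induction n) (auto simp: LTPar_pow_def)

lemma erase_inst_type:
  "erase_linty (inst_ptype \<phi> F) = erase_ptype F"
  "erase_linty (inst_linpty \<phi> A) = erase_linpty A"
  "erase_arbty (inst_bangpty \<phi> D) = erase_bangpty D"
  by (induction F and A and D) (auto simp: erase_LTPar_pow)

lemma linty_decompose:
  obtains k B where "A = LTPar_pow k B" "\<nexists>C. B = LTPar C"
proof -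
  have "\<exists>k B. A = LTPar_pow k B \<and> (\<nexists>C. B = LTPar C)"
  \<comment> \<open>The induction rule is mutual; arbitrary types get a trivial predicate because
    only the outermost run of \<open>LTPar\<close> matters.\<close>
  proof (induction A rule: linty.induct[where ?P2.0 = "\<lambda>_. True"])
    case (LTPar A)
    then obtain k B where "A = LTPar_pow k B" "\<nexists>C. B = LTPar C" by blast
    then show ?case by (intro exI[of _ "Suc k"] exI[of _ B]) (simp add: LTPar_pow_def)
  qed (rule exI[of _ 0], simp add: LTPar_pow_def | rule TrueI)+
  with that show ?thesis by blast
qed

text \<open>Each exponent is one parameter, so it can be set to the length of the corresponding run
  of modalities, and distinctness prevents conflicts. A \<open>ptype\<close> has no exponent at its
  root, which is why its target \<open>B\<close> must not start with \<open>LTPar\<close>. The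
  starting point \<phi> is arbitrary so that parts can be processed in sequence.\<close>

lemma inst_type_exists:
  "single_ptype F \<Longrightarrow> distinct (params_ptype F) \<Longrightarrow> erase_ptype F = erase_linty B \<Longrightarrow>
     \<nexists>C. B = LTPar C \<Longrightarrow>
     \<exists>\<psi>. agree_on (- set (params_ptype F)) \<psi> \<phi> \<and> admissible_ptype \<psi> F \<and> inst_ptype \<psi> F = B"
  "single_linpty A \<Longrightarrow> distinct (params_linpty A) \<Longrightarrow> erase_linpty A = erase_linty B \<Longrightarrow>
     \<exists>\<psi>. agree_on (- set (params_linpty A)) \<psi> \<phi> \<and> admissible_linpty \<psi> A \<and> inst_linpty \<psi> A = B"
  "single_bangpty D \<Longrightarrow> distinct (params_bangpty D) \<Longrightarrow> erase_bangpty D = erase_arbty E \<Longrightarrow>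
     \<exists>\<psi>. agree_on (- set (params_bangpty D)) \<psi> \<phi> \<and> admissible_bangpty \<psi> D \<and> inst_bangpty \<psi> D = E"
proof (induction F and A and D arbitrary: B \<phi> and B \<phi> and E \<phi>)
  case (PTVar i)
  then show ?case by (intro exI[of _ \<phi>]) (cases B; auto intro: agree_on_refl)
next
  case (PTFun D A)
  obtain E C where B: "B = LTFun E C" "erase_bangpty D = erase_arbty E"
    "erase_linpty A = erase_linty C"
    using PTFun.prems by (cases B) auto
  obtain \<chi> where \<chi>: "agree_on (- set (params_bangpty D)) \<chi> \<phi>" "admissible_bangpty \<chi> D"
    "inst_bangpty \<chi> D = E"
    using PTFun.IH(1)[of E \<phi>] PTFun.prems B by auto
  obtain \<psi> where \<psi>: "agree_on (- set (params_linpty A)) \<psi> \<chi>" "admissible_linpty \<psi> A"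
    "inst_linpty \<psi> A = C"
    using PTFun.IH(2)[of C \<chi>] PTFun.prems B by auto
  \<comment> \<open>\<psi> was built on top of \<chi> by changing parameters of \<open>A\<close>
    only; by distinctness the values chosen for \<open>D\<close> survive.\<close>
  have "agree_on (set (params_bangpty D)) \<psi> \<chi>"
    using \<psi>(1) by (rule agree_on_mono) (use PTFun.prems in auto)
  then have "inst_bangpty \<psi> D = E" "admissible_bangpty \<psi> D"
    using inst_type_cong(3) \<chi> by auto
  moreover have "agree_on (- set (params_ptype (PTFun D A))) \<psi> \<phi>"
    by (rule agree_on_trans[of _ _ \<chi>]) (use \<chi>(1) \<psi>(1) in \<open>auto elim: agree_on_mono\<close>)
  ultimately show ?case using \<psi> B by (intro exI[of _ \<psi>]) auto
next
  case (PTAll A)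
  then obtain C where "B = LTAll C" "erase_linpty A = erase_linty C" by (cases B) auto
  then show ?case using PTAll.IH[of C \<phi>] PTAll.prems by auto
next
  case (LPar c F)
  obtain n where c: "c = [n]" using LPar.prems by auto
  obtain k C where B: "B = LTPar_pow k C" "\<nexists>C'. C = LTPar C'" by (rule linty_decompose)
  \<comment> \<open>The root exponent is set first and the induction hypothesis is applied to the
    updated instantiation; since \<open>n\<close> does not occur in \<open>F\<close>, it keeps the
    value \<open>k\<close>.\<close>
  obtain \<psi> where \<psi>: "agree_on (- set (params_ptype F)) \<psi> (fst \<phi>, (snd \<phi>)(n := int k))"
    "admissible_ptype \<psi> F" "inst_ptype \<psi> F = C"
    using LPar.IH[of C "(fst \<phi>, (snd \<phi>)(n := int k))"] LPar.prems B
    by (auto simp: erase_LTPar_pow)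
  have "snd \<psi> n = int k" using \<psi>(1) LPar.prems c by (auto simp: agree_on_def)
  moreover have "agree_on (- set (params_linpty (LPar c F))) \<psi> \<phi>"
    using \<psi>(1) c by (auto simp: agree_on_def)
  ultimately show ?case using \<psi> B c by (intro exI[of _ \<psi>]) (auto simp: lincomb_val_single)
next
  case (BPar b c F)
  obtain n where c: "c = [n]" using BPar.prems by auto
  obtain v A where E: "E = (if v then ABang A else ALin A)" by (cases E) (metis (full_types))+
  obtain k C where A: "A = LTPar_pow k C" "\<nexists>C'. C = LTPar C'" by (rule linty_decompose)
  \<comment> \<open>A bang replaces one paragraph of the exponent, so a bang followed by
    \<open>k\<close> paragraphs comes from the exponent \<open>k + 1\<close>. This also gives the
    bound of at least 1 that admissibility demands when the boolean is true.\<close>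
  define k' where "k' = (if v then int k + 1 else int k)"
  let ?\<chi> = "((fst \<phi>)(b := v), (snd \<phi>)(n := k'))"
  have "erase_ptype F = erase_linty C"
    using BPar.prems A E by (auto simp: erase_LTPar_pow split: if_splits)
  then obtain \<psi> where \<psi>: "agree_on (- set (params_ptype F)) \<psi> ?\<chi>"
    "admissible_ptype \<psi> F" "inst_ptype \<psi> F = C"
    using BPar.IH[of C ?\<chi>] BPar.prems A by auto
  have "snd \<psi> n = k'" "fst \<psi> b = v" using \<psi>(1) BPar.prems c by (auto simp: agree_on_def)
  moreover have "agree_on (- set (params_bangpty (BPar b c F))) \<psi> \<phi>"
    using \<psi>(1) c by (auto simp: agree_on_def)
  ultimately show ?case
    using \<psi> A E c by (intro exI[of _ \<psi>]) (auto simp: lincomb_val_single k'_def)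
qed


section \<open>Instantiated p-terms, powers of modalities and regularity\<close>

section \<open>Terms\<close>

text \<open>\<open>own_params\<close> omits the parameters of free variables, which the environment
  supplies; hence the separate hypothesis on \<Theta>.\<close>

lemma inst_pterm_cong:
  "decorates \<Theta> M P \<Longrightarrow> agree_on (set (own_params P)) \<phi> \<psi> \<Longrightarrow>
     \<forall>i\<in>free_vars M. agree_on (set (params_bangpty (\<Theta> i))) \<phi> \<psi> \<Longrightarrow>
     inst_pterm \<phi> P = inst_pterm \<psi> P \<and> admissible_pterm \<phi> P = admissible_pterm \<psi> P"
proof (induction rule: decorates.induct)
  case (dec_Var \<Theta> i T m)
  then show ?case
    using inst_type_cong(3)[of "\<Theta> i" \<phi> \<psi>] by (auto simp: agree_on_def)
next
  case (dec_Lam T D \<Theta> M t m)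
  \<comment> \<open>The decoration of the bound variable becomes an environment entry of the body,
    and its parameters are own parameters of the abstraction.\<close>
  have "\<forall>i\<in>free_vars M. agree_on (set (params_bangpty (case_nat D \<Theta> i))) \<phi> \<psi>"
    using dec_Lam.prems by (auto simp: agree_on_def split: nat.split)
  moreover have "agree_on (set (own_params t)) \<phi> \<psi>" "agree_on (set (params_bangpty D)) \<phi> \<psi>"
    "snd \<phi> m = snd \<psi> m"
    using dec_Lam.prems by (auto simp: agree_on_def)
  ultimately show ?case using dec_Lam.IH inst_type_cong(3) by simp
next
  case (dec_App \<Theta> M t N s m)
  then have "agree_on (set (own_params t)) \<phi> \<psi>" "agree_on (set (own_params s)) \<phi> \<psi>"
    "snd \<phi> m = snd \<psi> m"
    by (auto simp: agree_on_def)
  then show ?case using dec_App by simp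
next
  case (dec_TLam \<Theta> M t m)
  then have "agree_on (set (own_params t)) \<phi> \<psi>" "snd \<phi> m = snd \<psi> m"
    by (auto simp: agree_on_def)
  then show ?case using dec_TLam by (simp add: params_shift)
next
  case (dec_TApp \<Theta> M t T A m)
  then have "agree_on (set (own_params t)) \<phi> \<psi>" "agree_on (set (params_linpty A)) \<phi> \<psi>"
    "snd \<phi> m = snd \<psi> m"
    by (auto simp: agree_on_def)
  then show ?case using dec_TApp inst_type_cong(2) by simp
qed

lemma erase_TPar_pow: "erase_pseudoterm (TPar_pow k u) = erase_pseudoterm u"
proof -
  have "erase_pseudoterm ((TPar ^^ n) u) = erase_pseudoterm u"
    "erase_pseudoterm ((TBar ^^ n) u) = erase_pseudoterm u" for n
    by (induction n) auto
  then show ?thesis by (simp add: TPar_pow_def)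
qed

lemma church_TPar_pow: "church_pseudoterm \<Delta> (TPar_pow k u) = church_pseudoterm \<Delta> u"
proof -
  have "church_pseudoterm \<Delta> ((TPar ^^ n) u) = church_pseudoterm \<Delta> u"
    "church_pseudoterm \<Delta> ((TBar ^^ n) u) = church_pseudoterm \<Delta> u" for n
    by (induction n) auto
  then show ?thesis by (simp add: TPar_pow_def)
qed

text \<open>This gives the direction from instantiations to decorations: instantiating only inserts
  modalities, in terms and in types, and erasure removes them again.\<close>

lemma erase_inst_pterm: "decorates \<Theta> M P \<Longrightarrow> erase_pseudoterm (inst_pterm \<phi> P) = M"
  by (induction rule: decorates.induct)
    (auto simp: erase_TPar_pow erase_inst_type free_bang_decoration_def free_linear_decoration_def)

lemma subterms_TPar_pow: "subterms u \<subseteq> subterms (TPar_pow k u)"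
proof -
  have "subterms u \<subseteq> subterms ((TPar ^^ n) u)" "subterms u \<subseteq> subterms ((TBar ^^ n) u)" for n
    by (induction n) auto
  then show ?thesis by (simp add: TPar_pow_def)
qed

lemma regular_subterm: "regular t \<Longrightarrow> subterms u \<subseteq> subterms t \<Longrightarrow> regular u"
  by (auto simp: regular_def)

text \<open>The sign condition matters: for negative \<open>k\<close>, increasing the exponent drops
  a \<open>TBar\<close> instead of adding a \<open>TPar\<close>.\<close>

lemma TPar_pow_nonneg_Suc: "0 \<le> k \<Longrightarrow> TPar_pow (k + 1) u = TPar (TPar_pow k u)"
  by (simp add: TPar_pow_def nat_add_distrib)

lemma TPar_pow_nonpos_Suc:
  assumes "k \<le> 0" shows "TPar_pow (k - 1) u = TBar (TPar_pow k u)"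
proof -
  have "nat (- (k - 1)) = Suc (nat (- k))" using assms by simp
  then show ?thesis using assms by (simp add: TPar_pow_def del: minus_diff_eq)
qed

lemma TPar_pow_pos: "0 < k \<Longrightarrow> \<exists>v. TPar_pow k u = TPar v"
  using TPar_pow_nonneg_Suc[of "k - 1"] by auto

lemma TPar_pow_neg: "k < 0 \<Longrightarrow> \<exists>v. TPar_pow k u = TBar v"
  using TPar_pow_nonpos_Suc[of "k + 1"] by auto

text \<open>If the body of a \<open>TPar\<close> had a negative exponent it would start with
  \<open>TBar\<close>, which regularity forbids; dually for \<open>TBar\<close>. So the modalities
  above a node are all of one kind and a single integer records them.\<close>

lemma regular_decompose:
  "regular t \<Longrightarrow> \<exists>k u. t = TPar_pow k u \<and> (\<nexists>v. u = TPar v) \<and> (\<nexists>v. u = TBar v)"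
proof (induction t)
  case (TPar t)
  have "regular t" by (rule regular_subterm[OF TPar.prems]) auto
  then obtain k u where *: "t = TPar_pow k u" "\<nexists>v. u = TPar v" "\<nexists>v. u = TBar v"
    using TPar.IH by blast
  have "\<nexists>v. t = TBar v" using TPar.prems by (auto simp: regular_def)
  then have "0 \<le> k" using TPar_pow_neg[of k u] * by force
  then show ?case using * TPar_pow_nonneg_Suc[of k u] by metis
next
  case (TBar t)
  have "regular t" by (rule regular_subterm[OF TBar.prems]) auto
  then obtain k u where *: "t = TPar_pow k u" "\<nexists>v. u = TPar v" "\<nexists>v. u = TBar v"
    using TBar.IH by blast
  have "\<nexists>v. t = TPar v" using TBar.prems by (auto simp: regular_def)
  then have "k \<le> 0" using TPar_pow_pos[of k u] * by force
  then show ?case using * TPar_pow_nonpos_Suc[of k u] by metis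
qed (rule exI[of _ 0], simp add: TPar_pow_def)+

section \<open>Reading an instantiation off a pseudo-term, relative to an environment\<close>

definition env_inst ::
  "nat set \<Rightarrow> param_inst \<Rightarrow> (nat \<Rightarrow> bangpty) \<Rightarrow> (nat \<Rightarrow> arbty) \<Rightarrow> bool" where
  "env_inst S \<phi> \<Theta> \<Delta> \<longleftrightarrow> (\<forall>i\<in>S. inst_bangpty \<phi> (\<Theta> i) = \<Delta> i \<and> admissible_bangpty \<phi> (\<Theta> i))"

text \<open>\<open>X\<close> stands for parameters about to receive new values. Here and in
  \<open>env_inst\<close> only indices in \<open>S\<close> count, because a free decoration
  constrains \<Theta> only at the free variables of the term.\<close>

definition env_fresh :: "nat set \<Rightarrow> (nat \<Rightarrow> bangpty) \<Rightarrow> param set \<Rightarrow> bool" where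
  "env_fresh S \<Theta> X \<longleftrightarrow> (\<forall>i\<in>S. X \<inter> set (params_bangpty (\<Theta> i)) = {})"

lemma env_inst_cong:
  assumes "env_inst S \<phi> \<Theta> \<Delta>" "agree_on (- X) \<psi> \<phi>" "env_fresh S \<Theta> X"
  shows "env_inst S \<psi> \<Theta> \<Delta>"
  unfolding env_inst_def
proof
  fix i assume i: "i \<in> S"
  have "agree_on (set (params_bangpty (\<Theta> i))) \<psi> \<phi>"
    using assms(2) by (rule agree_on_mono) (use i assms(3) in \<open>auto simp: env_fresh_def\<close>)
  then show "inst_bangpty \<psi> (\<Theta> i) = \<Delta> i \<and> admissible_bangpty \<psi> (\<Theta> i)"
    using inst_type_cong(3) assms(1) i by (auto simp: env_inst_def)
qed

text \<open>This serves applications, where the function is treated before the argument and its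
  instance must not be spoiled afterwards.\<close>

lemma inst_pterm_stable:
  assumes "decorates \<Theta> M P" "agree_on (- X) \<psi> \<phi>" "env_fresh (free_vars M) \<Theta> X"
    "set (own_params P) \<inter> X = {}"
  shows "inst_pterm \<psi> P = inst_pterm \<phi> P" "admissible_pterm \<psi> P = admissible_pterm \<phi> P"
proof -
  have "agree_on (set (own_params P)) \<psi> \<phi>"
    using assms(2) by (rule agree_on_mono) (use assms(4) in auto)
  moreover have "\<forall>i\<in>free_vars M. agree_on (set (params_bangpty (\<Theta> i))) \<psi> \<phi>"
    using assms(2,3) by (auto simp: env_fresh_def elim!: agree_on_mono)
  ultimately show "inst_pterm \<psi> P = inst_pterm \<phi> P"
    "admissible_pterm \<psi> P = admissible_pterm \<phi> P"
    using inst_pterm_cong[OF assms(1)] by auto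
qed

text \<open>The induction carries an instantiation \<phi> that already realises the annotations of
  the free variables, and \<psi> resets own parameters only. At each node the root exponent is taken
  from \<open>regular_decompose\<close>; the components are then treated in turn, each from the
  instantiation obtained so far.\<close>

lemma inst_pterm_exists:
  "decorates \<Theta> M P \<Longrightarrow> church_pseudoterm \<Delta> t \<Longrightarrow> regular t \<Longrightarrow> erase_pseudoterm t = M \<Longrightarrow>
     distinct (own_params P) \<Longrightarrow> env_fresh (free_vars M) \<Theta> (set (own_params P)) \<Longrightarrow>
     env_inst (free_vars M) \<phi> \<Theta> \<Delta> \<Longrightarrow>
     \<exists>\<psi>. agree_on (- set (own_params P)) \<psi> \<phi> \<and> admissible_pterm \<psi> P \<and> inst_pterm \<psi> P = t"
proof (induction arbitrary: \<Delta> t \<phi> rule: decorates.induct)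
  case (dec_Var \<Theta> i T m)
  obtain k u where t: "t = TPar_pow k u" "\<nexists>v. u = TPar v" "\<nexists>v. u = TBar v"
    using regular_decompose[OF dec_Var.prems(2)] by blast
  \<comment> \<open>Church style forces the annotation to be the environment entry, which \<phi>
    already produces from \<open>\<Theta> i\<close>; only \<open>m\<close> remains to be
    set.\<close>
  obtain D where u: "u = TVar i D" "D = \<Delta> i"
    using dec_Var.prems t by (cases u) (auto simp: erase_TPar_pow church_TPar_pow)
  define \<phi>' where "\<phi>' = (fst \<phi>, (snd \<phi>)(m := k))"
  have a: "agree_on (- {IntP m}) \<phi>' \<phi>" by (auto simp: \<phi>'_def agree_on_def)
  have "env_inst {i} \<phi>' \<Theta> \<Delta>"
    by (rule env_inst_cong[OF _ a]) (use dec_Var.prems in \<open>simp_all add: env_fresh_def\<close>)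
  then show ?case using a t u by (intro exI[of _ \<phi>']) (auto simp: env_inst_def \<phi>'_def)
next
  case (dec_Lam T D \<Theta> M p m)
  obtain k u where t: "t = TPar_pow k u" "\<nexists>v. u = TPar v" "\<nexists>v. u = TBar v"
    using regular_decompose[OF dec_Lam.prems(2)] by blast
  obtain E s where u: "u = TLam E s" "erase_arbty E = T" "erase_pseudoterm s = M"
    using dec_Lam.prems(3) t by (cases u) (auto simp: erase_TPar_pow)
  have ch: "church_pseudoterm (case_nat E \<Delta>) s"
    using dec_Lam.prems(1) by (simp add: t u church_TPar_pow)
  have rg: "regular s"
    by (rule regular_subterm[OF dec_Lam.prems(2)]) (use subterms_TPar_pow[of u k] t u in auto)
  define \<phi>' where "\<phi>' = (fst \<phi>, (snd \<phi>)(m := k))"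
  \<comment> \<open>The binder receives its values before the body is entered, so the extended
    environment is realised when the bound variable is met.\<close>
  obtain \<chi> where \<chi>: "agree_on (- set (params_bangpty D)) \<chi> \<phi>'" "admissible_bangpty \<chi> D"
    "inst_bangpty \<chi> D = E"
    using inst_type_exists(3)[of D E \<phi>'] dec_Lam.hyps(1) u by (auto simp: free_bang_decoration_def)
  let ?X = "insert (IntP m) (set (params_bangpty D))"
  have a: "agree_on (- ?X) \<chi> \<phi>" using \<chi>(1) by (auto simp: \<phi>'_def agree_on_def)
  have "env_fresh (free_vars (FLam T M)) \<Theta> ?X"
    using dec_Lam.prems(5) by (auto simp: env_fresh_def)
  from env_inst_cong[OF dec_Lam.prems(6) a this]
  have "env_inst (free_vars M) \<chi> (case_nat D \<Theta>) (case_nat E \<Delta>)"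
    using \<chi> by (auto simp: env_inst_def split: nat.split)
  moreover have "env_fresh (free_vars M) (case_nat D \<Theta>) (set (own_params p))"
    using dec_Lam.prems(4,5) by (auto simp: env_fresh_def split: nat.split)
  moreover have "distinct (own_params p)" using dec_Lam.prems(4) by simp
  ultimately obtain \<psi> where \<psi>: "agree_on (- set (own_params p)) \<psi> \<chi>" "admissible_pterm \<psi> p"
    "inst_pterm \<psi> p = s"
    using dec_Lam.IH[OF ch rg u(3)] by blast
  have "agree_on (set (params_bangpty D)) \<psi> \<chi>"
    using \<psi>(1) by (rule agree_on_mono) (use dec_Lam.prems(4) in auto)
  then have "inst_bangpty \<psi> D = E" "admissible_bangpty \<psi> D"
    using inst_type_cong(3) \<chi> by auto
  moreover have "snd \<psi> m = k"
    using \<psi>(1) \<chi>(1) dec_Lam.prems(4) by (auto simp: agree_on_def \<phi>'_def)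
  moreover have "agree_on (- set (own_params (PPar m (PLam D p)))) \<psi> \<phi>"
    by (rule agree_on_trans[of _ _ \<chi>]) (use \<psi>(1) a in \<open>auto elim!: agree_on_mono\<close>)
  ultimately show ?case using \<psi> t u by (intro exI[of _ \<psi>]) auto
next
  case (dec_App \<Theta> M p N q m)
  obtain k u where t: "t = TPar_pow k u" "\<nexists>v. u = TPar v" "\<nexists>v. u = TBar v"
    using regular_decompose[OF dec_App.prems(2)] by blast
  obtain r s where u: "u = TApp r s" "erase_pseudoterm r = M" "erase_pseudoterm s = N"
    using dec_App.prems(3) t by (cases u) (auto simp: erase_TPar_pow)
  have ch: "church_pseudoterm \<Delta> r" "church_pseudoterm \<Delta> s"
    using dec_App.prems(1) by (simp_all add: t u church_TPar_pow)
  have rg: "regular r" "regular s"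
    by (rule regular_subterm[OF dec_App.prems(2)], use subterms_TPar_pow[of u k] t u in auto)+
  define \<phi>' where "\<phi>' = (fst \<phi>, (snd \<phi>)(m := k))"
  have a: "agree_on (- {IntP m}) \<phi>' \<phi>" by (auto simp: \<phi>'_def agree_on_def)
  \<comment> \<open>The set \<open>X\<close> is left open because freshness is used for
    \<open>{IntP m}\<close> and for the own parameters of \<open>p\<close> and of
    \<open>q\<close>.\<close>
  have f: "env_fresh (free_vars M \<union> free_vars N) \<Theta> X"
    if "X \<subseteq> set (own_params (PPar m (PApp p q)))" for X
    using dec_App.prems(5) that by (auto simp: env_fresh_def)
  have fM: "env_fresh (free_vars M) \<Theta> X" and fN: "env_fresh (free_vars N) \<Theta> X"
    if "X \<subseteq> set (own_params (PPar m (PApp p q)))" for X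
    using f[OF that] by (auto simp: env_fresh_def)
  have "env_inst (free_vars M) \<phi> \<Theta> \<Delta>" "env_inst (free_vars N) \<phi> \<Theta> \<Delta>"
    using dec_App.prems(6) by (auto simp: env_inst_def)
  then have e: "env_inst (free_vars M) \<phi>' \<Theta> \<Delta>" "env_inst (free_vars N) \<phi>' \<Theta> \<Delta>"
    by (auto elim!: env_inst_cong[OF _ a] intro: fM fN)
  obtain \<chi> where \<chi>: "agree_on (- set (own_params p)) \<chi> \<phi>'" "admissible_pterm \<chi> p"
    "inst_pterm \<chi> p = r"
    using dec_App.IH(1)[OF ch(1) rg(1) u(2) _ fM e(1)] dec_App.prems(4) by auto
  \<comment> \<open>Choosing values for \<open>p\<close> changed none of the parameters in the
    environment, so the argument can start from \<chi>.\<close>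
  have "env_inst (free_vars N) \<chi> \<Theta> \<Delta>" by (rule env_inst_cong[OF e(2) \<chi>(1) fN]) auto
  then obtain \<psi> where \<psi>: "agree_on (- set (own_params q)) \<psi> \<chi>" "admissible_pterm \<psi> q"
    "inst_pterm \<psi> q = s"
    using dec_App.IH(2)[OF ch(2) rg(2) u(3) _ fN, of \<chi>] dec_App.prems(4) by auto
  have "inst_pterm \<psi> p = r" "admissible_pterm \<psi> p"
    using inst_pterm_stable[OF dec_App.hyps(1) \<psi>(1) fM] dec_App.prems(4) \<chi> by auto
  moreover have "snd \<psi> m = k"
    using \<psi>(1) \<chi>(1) dec_App.prems(4) by (auto simp: agree_on_def \<phi>'_def)
  moreover have "agree_on (- set (own_params (PPar m (PApp p q)))) \<psi> \<phi>"
    using \<psi>(1) \<chi>(1) a by (auto simp: agree_on_def)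
  ultimately show ?case using \<psi> t u by (intro exI[of _ \<psi>]) auto
next
  case (dec_TLam \<Theta> M p m)
  obtain k u where t: "t = TPar_pow k u" "\<nexists>v. u = TPar v" "\<nexists>v. u = TBar v"
    using regular_decompose[OF dec_TLam.prems(2)] by blast
  obtain s where u: "u = TTLam s" "erase_pseudoterm s = M"
    using dec_TLam.prems(3) t by (cases u) (auto simp: erase_TPar_pow)
  have ch: "church_pseudoterm (\<lambda>i. shift_arbty 0 (\<Delta> i)) s"
    using dec_TLam.prems(1) by (simp add: t u church_TPar_pow)
  have rg: "regular s"
    by (rule regular_subterm[OF dec_TLam.prems(2)]) (use subterms_TPar_pow[of u k] t u in auto)
  define \<phi>' where "\<phi>' = (fst \<phi>, (snd \<phi>)(m := k))"
  have a: "agree_on (- {IntP m}) \<phi>' \<phi>" by (auto simp: \<phi>'_def agree_on_def)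
  have "env_inst (free_vars (FTLam M)) \<phi>' \<Theta> \<Delta>"
    by (rule env_inst_cong[OF dec_TLam.prems(6) a])
      (use dec_TLam.prems(5) in \<open>auto simp: env_fresh_def\<close>)
  then have "env_inst (free_vars M) \<phi>' (\<lambda>i. shift_bangpty 0 (\<Theta> i)) (\<lambda>i. shift_arbty 0 (\<Delta> i))"
    by (auto simp: env_inst_def inst_shift admissible_shift)
  moreover have "env_fresh (free_vars M) (\<lambda>i. shift_bangpty 0 (\<Theta> i)) (set (own_params p))"
    using dec_TLam.prems(5) by (auto simp: env_fresh_def params_shift)
  moreover have "distinct (own_params p)" using dec_TLam.prems(4) by simp
  ultimately obtain \<psi> where \<psi>: "agree_on (- set (own_params p)) \<psi> \<phi>'" "admissible_pterm \<psi> p"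
    "inst_pterm \<psi> p = s"
    using dec_TLam.IH[OF ch rg u(2)] by blast
  have "snd \<psi> m = k" using \<psi>(1) dec_TLam.prems(4) by (auto simp: agree_on_def \<phi>'_def)
  moreover have "agree_on (- set (own_params (PPar m (PTLam p)))) \<psi> \<phi>"
    using \<psi>(1) a by (auto simp: agree_on_def)
  ultimately show ?case using \<psi> t u by (intro exI[of _ \<psi>]) auto
next
  case (dec_TApp \<Theta> M p T A m)
  obtain k u where t: "t = TPar_pow k u" "\<nexists>v. u = TPar v" "\<nexists>v. u = TBar v"
    using regular_decompose[OF dec_TApp.prems(2)] by blast
  obtain s B where u: "u = TTApp s B" "erase_linty B = T" "erase_pseudoterm s = M"
    using dec_TApp.prems(3) t by (cases u) (auto simp: erase_TPar_pow)
  have ch: "church_pseudoterm \<Delta> s"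
    using dec_TApp.prems(1) by (simp add: t u church_TPar_pow)
  have rg: "regular s"
    by (rule regular_subterm[OF dec_TApp.prems(2)]) (use subterms_TPar_pow[of u k] t u in auto)
  define \<phi>' where "\<phi>' = (fst \<phi>, (snd \<phi>)(m := k))"
  \<comment> \<open>The type argument is settled before the term \<open>p\<close>; its parameters
    are distinct from the own parameters of \<open>p\<close>, so its instance is still correct under
    the final \<psi>.\<close>
  obtain \<chi> where \<chi>: "agree_on (- set (params_linpty A)) \<chi> \<phi>'" "admissible_linpty \<chi> A"
    "inst_linpty \<chi> A = B"
    using inst_type_exists(2)[of A B \<phi>'] dec_TApp.hyps u by (auto simp: free_linear_decoration_def)
  let ?X = "insert (IntP m) (set (params_linpty A))"
  have a: "agree_on (- ?X) \<chi> \<phi>" using \<chi>(1) by (auto simp: \<phi>'_def agree_on_def)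
  have "env_fresh (free_vars (FTApp M T)) \<Theta> ?X"
    using dec_TApp.prems(5) by (auto simp: env_fresh_def)
  from env_inst_cong[OF dec_TApp.prems(6) a this]
  have "env_inst (free_vars M) \<chi> \<Theta> \<Delta>" by simp
  moreover have "env_fresh (free_vars M) \<Theta> (set (own_params p))"
    using dec_TApp.prems(5) by (auto simp: env_fresh_def)
  moreover have "distinct (own_params p)" using dec_TApp.prems(4) by simp
  ultimately obtain \<psi> where \<psi>: "agree_on (- set (own_params p)) \<psi> \<chi>" "admissible_pterm \<psi> p"
    "inst_pterm \<psi> p = s"
    using dec_TApp.IH[OF ch rg u(3)] by blast
  have "agree_on (set (params_linpty A)) \<psi> \<chi>"
    using \<psi>(1) by (rule agree_on_mono) (use dec_TApp.prems(4) in auto)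
  then have "inst_linpty \<psi> A = B" "admissible_linpty \<psi> A"
    using inst_type_cong(2) \<chi> by auto
  moreover have "snd \<psi> m = k"
    using \<psi>(1) \<chi>(1) dec_TApp.prems(4) by (auto simp: agree_on_def \<phi>'_def)
  moreover have "agree_on (- set (own_params (PPar m (PTApp p A)))) \<psi> \<phi>"
    by (rule agree_on_trans[of _ _ \<chi>]) (use \<psi>(1) a in \<open>auto elim!: agree_on_mono\<close>)
  ultimately show ?case using \<psi> t u by (intro exI[of _ \<psi>]) auto
qed


section \<open>Church-style environments and the values for free variables\<close>

section \<open>Environments\<close>

lemma shift_ftype_inject: "shift_ftype k T = shift_ftype k U \<Longrightarrow> T = U"
proof (induction T arbitrary: k U)
  case (FTVar i)
  then show ?case by (cases U) (auto simp: shift_ix_def split: if_splits)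
next
  case (FTFun T1 T2)
  then show ?case by (cases U) auto
next
  case (FTAll T)
  then show ?case by (cases U) auto
qed

text \<open>Every free occurrence records its type, so the term determines the environment at its
  free variables. Under a type abstraction the entries are compared after shifting, and injectivity
  of the shift recovers the originals.\<close>

lemma church_fterm_unique:
  "church_fterm \<Gamma> M \<Longrightarrow> church_fterm \<Gamma>' M \<Longrightarrow> i \<in> free_vars M \<Longrightarrow> \<Gamma> i = \<Gamma>' i"
proof (induction M arbitrary: \<Gamma> \<Gamma>' i)
  case (FLam T M)
  then have "case_nat T \<Gamma> (Suc i) = case_nat T \<Gamma>' (Suc i)"
    by (metis church_fterm.simps(2) free_vars.simps(2) mem_Collect_eq)
  then show ?case by simp
next
  case (FTLam M)
  then have "shift_ftype 0 (\<Gamma> i) = shift_ftype 0 (\<Gamma>' i)"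
    by (metis (no_types, lifting) church_fterm.simps(4) free_vars.simps(4))
  then show ?case by (rule shift_ftype_inject)
qed auto

lemma case_nat_comp: "f (case_nat x g i) = case_nat (f x) (\<lambda>j. f (g j)) i"
  by (simp split: nat.split)

lemma church_decorates: "decorates \<Theta> M P \<Longrightarrow> church_fterm (\<lambda>i. erase_bangpty (\<Theta> i)) M"
  by (induction rule: decorates.induct)
    (auto simp: free_bang_decoration_def erase_shift_ptype case_nat_comp[of erase_bangpty])

lemma erase_shift_type:
  "erase_linty (shift_linty k A) = shift_ftype k (erase_linty A)"
  "erase_arbty (shift_arbty k D) = shift_ftype k (erase_arbty D)"
  by (induction A and D arbitrary: k and k) auto

lemma church_erase_pseudoterm:
  "church_pseudoterm \<Delta> t \<Longrightarrow> church_fterm (\<lambda>i. erase_arbty (\<Delta> i)) (erase_pseudoterm t)"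
proof (induction t arbitrary: \<Delta>)
  case (TLam D t)
  then have "church_fterm (\<lambda>i. erase_arbty (case_nat D \<Delta> i)) (erase_pseudoterm t)" by simp
  then show ?case by (simp add: case_nat_comp[of erase_arbty])
next
  case (TTLam t)
  then have "church_fterm (\<lambda>i. erase_arbty (shift_arbty 0 (\<Delta> i))) (erase_pseudoterm t)" by simp
  then show ?case by (simp add: erase_shift_type)
qed auto

text \<open>Free variables are treated one at a time; disjointness of their parameter sets keeps the
  earlier entries intact. The result is the starting instantiation for
  \<open>inst_pterm_exists\<close>.\<close>

lemma env_inst_exists:
  "finite S \<Longrightarrow> \<forall>i\<in>S. free_bang_decoration (erase_arbty (\<Delta> i)) (\<Theta> i) \<Longrightarrow>
     \<forall>i\<in>S. \<forall>j\<in>S. i \<noteq> j \<longrightarrow>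
       set (params_bangpty (\<Theta> i)) \<inter> set (params_bangpty (\<Theta> j)) = {} \<Longrightarrow>
     \<exists>\<phi>. env_inst S \<phi> \<Theta> \<Delta>"
proof (induction S rule: finite_induct)
  case empty
  show ?case by (simp add: env_inst_def)
next
  case (insert k S)
  then obtain \<phi> where \<phi>: "env_inst S \<phi> \<Theta> \<Delta>" by auto
  obtain \<psi> where \<psi>: "agree_on (- set (params_bangpty (\<Theta> k))) \<psi> \<phi>"
    "admissible_bangpty \<psi> (\<Theta> k)" "inst_bangpty \<psi> (\<Theta> k) = \<Delta> k"
    using inst_type_exists(3)[of "\<Theta> k" "\<Delta> k" \<phi>] insert.prems(1)
    by (auto simp: free_bang_decoration_def)
  have "env_fresh S \<Theta> (set (params_bangpty (\<Theta> k)))"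
    unfolding env_fresh_def using insert.prems(2) insert.hyps(2) by auto
  then have "env_inst S \<psi> \<Theta> \<Delta>" by (rule env_inst_cong[OF \<phi> \<psi>(1)])
  then show ?case using \<psi> by (intro exI[of _ \<psi>]) (auto simp: env_inst_def)
qed

theorem theorem4p1:
  fixes M :: fterm and t :: pseudoterm and P :: pterm
  assumes "system_F_term M"
    and "pseudo_term t" and "regular t"
    and "free_decoration M P"
  shows "decoration_of t M \<longleftrightarrow>
    (\<exists>\<phi>. admissible_pterm \<phi> P \<and> inst_pterm \<phi> P = t)"
proof -
  obtain \<Theta> where \<Theta>: "decorates \<Theta> M P"
    "\<forall>i\<in>free_vars M. free_bang_decoration (erase_bangpty (\<Theta> i)) (\<Theta> i)"
    "\<forall>i\<in>free_vars M. \<forall>j\<in>free_vars M. i \<noteq> j \<longrightarrow>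
       set (params_bangpty (\<Theta> i)) \<inter> set (params_bangpty (\<Theta> j)) = {}"
    "distinct (own_params P)"
    "\<forall>i\<in>free_vars M. set (own_params P) \<inter> set (params_bangpty (\<Theta> i)) = {}"
    using assms(4) unfolding free_decoration_def by blast
  show ?thesis
  proof
    assume "decoration_of t M"
    then have er: "erase_pseudoterm t = M" by (simp add: decoration_of_def)
    obtain \<Delta> where \<Delta>: "church_pseudoterm \<Delta> t" using assms(2) by (auto simp: pseudo_term_def)
    \<comment> \<open>\<open>M\<close> satisfies the Church condition both for the erasure of
      \<Theta>, as a decorated term, and for that of \<Delta>, as the erasure of \<open>t\<close>;
      so the two agree at its free variables.\<close>
    have "erase_bangpty (\<Theta> i) = erase_arbty (\<Delta> i)" if "i \<in> free_vars M" for i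
      using church_fterm_unique[OF church_decorates[OF \<Theta>(1)] _ that]
        church_erase_pseudoterm[OF \<Delta>] er by auto
    then obtain \<phi> where "env_inst (free_vars M) \<phi> \<Theta> \<Delta>"
      using env_inst_exists[OF finite_free_vars _ \<Theta>(3), of \<Delta>] \<Theta>(2) by auto
    \<comment> \<open>The own parameters of \<open>P\<close> avoid those of the free variables, so
      they can be set on top of the \<phi> just obtained.\<close>
    then show "\<exists>\<phi>. admissible_pterm \<phi> P \<and> inst_pterm \<phi> P = t"
      using inst_pterm_exists[OF \<Theta>(1) \<Delta> assms(3) er \<Theta>(4)] \<Theta>(5)
      unfolding env_fresh_def by blast
  next
    assume "\<exists>\<phi>. admissible_pterm \<phi> P \<and> inst_pterm \<phi> P = t"
    then show "decoration_of t M"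
      using erase_inst_pterm[OF \<Theta>(1)] by (auto simp: decoration_of_def)
  qed
qed

end
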